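(* Let $L\subset U$ be a subspace containing $\{\mathbf{R}_U^{-1}\mathbf{l}(\mu):\mu\in\mathcal{P}\}$. If $\mathbf{\Theta}$ is a $U\to\ell_2$ $\varepsilon$-subspace embedding for $L+U_r+W_p$, then $$|s_r(\mu)-s^\star_r(\mu)|\le\varepsilon\,\|\mathbf{l}(\mu)\|_{U'}\,\|\mathbf{u}_r(\mu)-\mathbf{w}_p(\mu)\|_U$$ holds for all $\mu\in\mathcal{P}$.
   Context: Let $\mathbb{K}=\mathbb{R}$ or $\mathbb{C}$, $U=U'=\mathbb{K}^n$, $\langle\cdot,\cdot\rangle$ the canonical $\ell_2$-inner product. $\mathbf{R}_U\in\mathbb{K}^{n\times n}$ is symmetric (Hermitian if $\mathbb{K}=\mathbb{C}$) positive definite. $U$ is equipped with $\langle\cdot,\cdot\rangle_U=\langle\mathbf{R}_U\cdot,\cdot\rangle$ and $U'$ with $\langle\cdot,\cdot\rangle_{U'}=\langle\cdot,\mathbf{R}_U^{-1}\cdot\rangle$; $\|\cdot\|_U,\|\cdot\|_{U'}$ are the associated norms. For $\mathbf{\Theta}\in\mathbb{K}^{k\times n}$, $\langle\mathbf{x},\mathbf{y}\rangle^{\mathbf{\Theta}}_U=\langle\mathbf{\Theta}\mathbf{x},\mathbf{\Theta}\mathbf{y}\rangle$. $\mathbf{\Theta}$ is a $U\to\ell_2$ $\varepsilon$-subspace embedding for a subspace $V\subset U$ if $|\langle\mathbf{x},\mathbf{y}\rangle_U-\langle\mathbf{x},\mathbf{y}\rangle^{\mathbf{\Theta}}_U|\le\varepsilon\|\mathbf{x}\|_U\|\mathbf{y}\|_U$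 for all $\mathbf{x},\mathbf{y}\in V$. $\mathcal{P}$ is a parameter set, $U_r,W_p\subset U$ are subspaces. For each $\mu\in\mathcal{P}$: $\mathbf{l}(\mu)\in U'$ (extractor of the quantity of interest), $\mathbf{u}_r(\mu)\in U_r$ (approximate solution), $\mathbf{w}_p(\mu)$ is the $\langle\cdot,\cdot\rangle_U$-orthogonal projection of $\mathbf{u}_r(\mu)$ onto $W_p$, and $$s_r(\mu)=\langle\mathbf{l}(\mu),\mathbf{u}_r(\mu)\rangle,\qquad s^\star_r(\mu)=\langle\mathbf{l}(\mu),\mathbf{w}_p(\mu)\rangle+\langle\mathbf{R}_U^{-1}\mathbf{l}(\mu),\mathbf{u}_r(\mu)-\mathbf{w}_p(\mu)\rangle^{\mathbf{\Theta}}_U.$$ *)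

theory Defs
  imports "HOL-Analysis.Analysis"
begin

text \<open>The scalar field \<open>\<bbbK>\<close> is \<open>\<real>\<close> or \<open>\<complex>\<close>. The class below allows both to be treated at once; its
  axioms admit, up to isomorphism, no other fields (see \<open>real_or_complex_cases\<close>).\<close>

class real_or_complex = real_normed_field +
  fixes conjg :: "'a \<Rightarrow> 'a"
    and re_part :: "'a \<Rightarrow> real"
  assumes conjg_add: "conjg (x + y) = conjg x + conjg y"
    and conjg_mult: "conjg (x * y) = conjg x * conjg y"
    and conjg_conjg: "conjg (conjg x) = x"
    and add_conjg_scaleR: "x + conjg x = scaleR (2 * re_part x) 1"
    and mult_conjg_scaleR: "x * conjg x = scaleR ((norm x)\<^sup>2) 1"

instantiation real :: real_or_complex
begin
definition conjg_real :: "real \<Rightarrow> real" where "conjg_real x = x"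
definition re_part_real :: "real \<Rightarrow> real" where "re_part_real x = x"
instance
  by standard (auto simp: conjg_real_def re_part_real_def power2_eq_square)
end

instantiation complex :: real_or_complex
begin
definition conjg_complex :: "complex \<Rightarrow> complex" where "conjg_complex z = cnj z"
definition re_part_complex :: "complex \<Rightarrow> real" where "re_part_complex z = Re z"
instance
  by standard
    (simp_all add: conjg_complex_def re_part_complex_def complex_eq_iff cmod_power2,
      simp_all add: power2_eq_square)
end

lemma add_conjg: "x + conjg x = of_real (2 * re_part (x::'a::real_or_complex))"
  using add_conjg_scaleR[of x] by (simp add: of_real_def)

lemma mult_conjg: "x * conjg x = of_real ((norm (x::'a::real_or_complex))\<^sup>2)"
  using mult_conjg_scaleR[of x] by (simp add: of_real_def)

lemma conjg_of_real: "conjg (of_real r :: 'a::real_or_complex) = of_real r"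
proof (cases "r = 0")
  case True
  have "conjg (0::'a) + conjg 0 = conjg 0"
    using conjg_add[of "0::'a" 0] by simp
  then show ?thesis using True by simp
next
  case False
  have "(of_real r :: 'a) * conjg (of_real r) = of_real r * of_real r"
    using mult_conjg[of "of_real r :: 'a"] by (simp add: power2_eq_square)
  then show ?thesis using False by simp
qed

lemma real_or_complex_cases:
  "(\<forall>x::'a::real_or_complex. x \<in> \<real>) \<or>
   (\<exists>i::'a. i * i = - 1 \<and> conjg i = - i \<and> (\<forall>z. \<exists>a b. z = of_real a + of_real b * i))"
proof (cases "\<forall>x::'a. x \<in> \<real>")
  case False
  then obtain x :: 'a where x: "x \<notin> \<real>" by blast
  define anti where "anti z = z - of_real (re_part z)" for z :: 'a
  have conjg_minus: "conjg (- z) = - conjg z" for z :: 'a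
    using conjg_mult[of "- 1" z] conjg_of_real[of "- 1", where 'a = 'a] by simp
  have anti: "conjg (anti z) = - anti z" for z
  proof -
    have "conjg (anti z) = conjg z - of_real (re_part z)"
      using conjg_add[of z "- of_real (re_part z)"]
      by (simp add: anti_def conjg_minus conjg_of_real)
    also have "conjg z = 2 * of_real (re_part z) - z"
      using add_conjg[of z] by (simp add: algebra_simps)
    finally show ?thesis by (simp add: anti_def)
  qed
  define y where "y = anti x"
  have y0: "y \<noteq> 0" using x unfolding y_def anti_def by (metis Reals_of_real eq_iff_diff_eq_0)
  define i where "i = y / of_real (norm y)"
  have yy: "y * y = - of_real (norm y * norm y)"
  proof -
    have "- (y * y) = of_real (norm y * norm y)"
      using mult_conjg[of y] anti[of x] unfolding y_def[symmetric] power2_eq_square by simp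
    then show ?thesis by (metis minus_minus)
  qed
  have ii: "i * i = - 1" using yy y0 by (simp add: i_def)
  have i_eq: "i = y * of_real (1 / norm y)" by (simp add: i_def field_simps)
  have ci: "conjg i = - i"
    using conjg_mult[of y "of_real (1 / norm y)"] anti[of x]
    unfolding i_eq y_def[symmetric] conjg_of_real by simp
  have "\<exists>a b. z = of_real a + of_real b * i" for z
  proof -
    have "conjg (anti z * i) = anti z * i" by (simp add: conjg_mult anti ci)
    then have "anti z * i = of_real (re_part (anti z * i))"
      using add_conjg[of "anti z * i"] unfolding mult_2[symmetric] of_real_mult by (simp add: mult.commute)
    then have "anti z * (i * i) = of_real (re_part (anti z * i)) * i"
      by (metis mult.assoc)
    then have "anti z = of_real (- re_part (anti z * i)) * i"
      unfolding ii of_real_minus by (metis minus_minus mult_minus_left mult_minus_right mult_1_right)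
    then have "z = of_real (re_part z) + of_real (- re_part (anti z * i)) * i"
      using anti_def[of z] by (metis diff_add_cancel add.commute)
    then show ?thesis by blast
  qed
  with ii ci show ?thesis by blast
qed blast

text \<open>Canonical inner product \<open>\<langle>x, y\<rangle> = x\<^sup>H y\<close>, conjugate-linear in the first argument.\<close>

definition l2_inner :: "'a::real_or_complex ^ 'n \<Rightarrow> 'a ^ 'n \<Rightarrow> 'a" where
  "l2_inner x y = (\<Sum>i\<in>UNIV. conjg (x $ i) * y $ i)"

definition conj_transpose :: "'a::real_or_complex ^ 'n ^ 'm \<Rightarrow> 'a ^ 'm ^ 'n" where
  "conj_transpose A = (\<chi> i j. conjg (A $ j $ i))"

text \<open>For \<open>\<bbbK> = \<real>\<close> the first condition says that the matrix is symmetric.\<close>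

definition hermitian_pos_def :: "'a::real_or_complex ^ 'n ^ 'n \<Rightarrow> bool" where
  "hermitian_pos_def A \<longleftrightarrow>
     conj_transpose A = A \<and> (\<forall>x. x \<noteq> 0 \<longrightarrow> 0 < re_part (l2_inner (A *v x) x))"

definition inner_U :: "'a::real_or_complex ^ 'n ^ 'n \<Rightarrow> 'a ^ 'n \<Rightarrow> 'a ^ 'n \<Rightarrow> 'a" where
  "inner_U R x y = l2_inner (R *v x) y"

definition norm_U :: "'a::real_or_complex ^ 'n ^ 'n \<Rightarrow> 'a ^ 'n \<Rightarrow> real" where
  "norm_U R x = sqrt (re_part (inner_U R x x))"

definition inner_U' :: "'a::real_or_complex ^ 'n ^ 'n \<Rightarrow> 'a ^ 'n \<Rightarrow> 'a ^ 'n \<Rightarrow> 'a" where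
  "inner_U' R x y = l2_inner x (matrix_inv R *v y)"

definition norm_U' :: "'a::real_or_complex ^ 'n ^ 'n \<Rightarrow> 'a ^ 'n \<Rightarrow> real" where
  "norm_U' R x = sqrt (re_part (inner_U' R x x))"

definition sketched_inner :: "'a::real_or_complex ^ 'n ^ 'k \<Rightarrow> 'a ^ 'n \<Rightarrow> 'a ^ 'n \<Rightarrow> 'a" where
  "sketched_inner \<Theta> x y = l2_inner (\<Theta> *v x) (\<Theta> *v y)"

definition subspace_embedding ::
  "'a::real_or_complex ^ 'n ^ 'n \<Rightarrow> real \<Rightarrow> 'a ^ 'n ^ 'k \<Rightarrow> ('a ^ 'n) set \<Rightarrow> bool" where
  "subspace_embedding R \<epsilon> \<Theta> V \<longleftrightarrow>
     (\<forall>x\<in>V. \<forall>y\<in>V. norm (inner_U R x y - sketched_inner \<Theta> x y) \<le> \<epsilon> * norm_U R x * norm_U R y)"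

definition is_U_orth_projection ::
  "'a::real_or_complex ^ 'n ^ 'n \<Rightarrow> ('a ^ 'n) set \<Rightarrow> 'a ^ 'n \<Rightarrow> 'a ^ 'n \<Rightarrow> bool" where
  "is_U_orth_projection R W u w \<longleftrightarrow> w \<in> W \<and> (\<forall>v\<in>W. inner_U R (u - w) v = 0)"

definition output_qoi :: "'a::real_or_complex ^ 'n \<Rightarrow> 'a ^ 'n \<Rightarrow> 'a" where
  "output_qoi l u = l2_inner l u"

definition corrected_output_qoi ::
  "'a::real_or_complex ^ 'n ^ 'n \<Rightarrow> 'a ^ 'n ^ 'k \<Rightarrow> 'a ^ 'n \<Rightarrow> 'a ^ 'n \<Rightarrow> 'a ^ 'n \<Rightarrow> 'a" where
  "corrected_output_qoi R \<Theta> l u w =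
     l2_inner l w + sketched_inner \<Theta> (matrix_inv R *v l) (u - w)"

end

theory Submission
  imports Defs
begin

text \<open>The vector \<open>g = R\<^sub>U\<^sup>-\<^sup>1 l\<close> is the Riesz representative of \<open>l\<close>, so with \<open>d = u\<^sub>r - w\<^sub>p\<close> the error
  is \<open>\<langle>g, d\<rangle>\<^sub>U - \<langle>g, d\<rangle>\<^sub>U\<^sup>\<Theta>\<close> and the embedding property applies to \<open>g\<close> and \<open>d\<close>, both of which lie
  in \<open>L + U\<^sub>r + W\<^sub>p\<close>.\<close>

lemma conjg_0 [simp]: "conjg (0::'a::real_or_complex) = 0"
  using conjg_of_real[of 0, where 'a = 'a] by simp

lemma re_part_0 [simp]: "re_part (0::'a::real_or_complex) = 0"
  using add_conjg[of "0::'a"] by simp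

lemma l2_inner_zero_left [simp]: "l2_inner 0 y = 0"
  by (simp add: l2_inner_def)

lemma l2_inner_diff_right: "l2_inner x (y - z) = l2_inner x y - l2_inner x z"
  by (simp add: l2_inner_def right_diff_distrib sum_subtractf)

text \<open>Definiteness forces a trivial kernel, and a square matrix over a field with trivial
  kernel is invertible.\<close>

lemma hermitian_pos_def_invertible:
  fixes A :: "'a::real_or_complex ^ 'n ^ 'n"
  assumes "hermitian_pos_def A"
  shows "invertible A"
proof -
  \<comment> \<open>A nonzero kernel vector would give \<open>0 < re_part (l2_inner 0 x)\<close>,
    whose right-hand side is 0.\<close>
  have "x = 0" if "A *v x = 0" for x
    using assms that unfolding hermitian_pos_def_def by force
  then show ?thesis
    unfolding invertible_left_inverse matrix_left_invertible_ker by blast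
qed

text \<open>\<open>matrix_inv\<close> is a Hilbert choice, so its defining property follows once
  some inverse exists.\<close>

lemma invertible_matrix_inv_right:
  fixes A :: "'a::semiring_1 ^ 'n ^ 'm"
  assumes "invertible A"
  shows "A ** matrix_inv A = mat 1"
  using assms unfolding invertible_def matrix_inv_def by (rule someI2_ex) simp

lemma hermitian_pos_def_mult_inv:
  fixes A :: "'a::real_or_complex ^ 'n ^ 'n"
  assumes "hermitian_pos_def A"
  shows "A *v (matrix_inv A *v x) = x"
  using invertible_matrix_inv_right[OF hermitian_pos_def_invertible[OF assms]]
  by (simp add: matrix_vector_mul_assoc)

text \<open>\<open>inner_U\<close> applies \<open>R\<close> to its first argument, where it cancels
  the inverse.\<close>

lemma inner_U_riesz:
  assumes "hermitian_pos_def R"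
  shows "inner_U R (matrix_inv R *v l) y = l2_inner l y"
  by (simp add: inner_U_def hermitian_pos_def_mult_inv[OF assms])

text \<open>The Riesz map is an isometry: take the representative itself as \<open>y\<close> in
  \<open>inner_U_riesz\<close>.\<close>

lemma norm_U_riesz:
  assumes "hermitian_pos_def R"
  shows "norm_U R (matrix_inv R *v l) = norm_U' R l"
  by (simp add: norm_U_def norm_U'_def inner_U'_def inner_U_riesz[OF assms])

theorem proposition8p5:
  fixes R\<^sub>U :: "'a::real_or_complex ^ 'n ^ 'n"
    and \<Theta> :: "'a ^ 'n ^ 'k"
    and \<epsilon> :: real
    and P :: "'p set"
    and U\<^sub>r W\<^sub>p L :: "('a ^ 'n) set"
    and l u\<^sub>r w\<^sub>p :: "'p \<Rightarrow> 'a ^ 'n"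
  assumes "hermitian_pos_def R\<^sub>U"
    and "vec.subspace U\<^sub>r" and "vec.subspace W\<^sub>p" and "vec.subspace L"
    and "\<And>\<mu>. \<mu> \<in> P \<Longrightarrow> u\<^sub>r \<mu> \<in> U\<^sub>r"
    and "\<And>\<mu>. \<mu> \<in> P \<Longrightarrow> is_U_orth_projection R\<^sub>U W\<^sub>p (u\<^sub>r \<mu>) (w\<^sub>p \<mu>)"
    and "{matrix_inv R\<^sub>U *v l \<mu> | \<mu>. \<mu> \<in> P} \<subseteq> L"
    and "subspace_embedding R\<^sub>U \<epsilon> \<Theta> {x + y + z | x y z. x \<in> L \<and> y \<in> U\<^sub>r \<and> z \<in> W\<^sub>p}"
  shows "\<forall>\<mu>\<in>P.
    norm (output_qoi (l \<mu>) (u\<^sub>r \<mu>) - corrected_output_qoi R\<^sub>U \<Theta> (l \<mu>) (u\<^sub>r \<mu>) (w\<^sub>p \<mu>))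
      \<le> \<epsilon> * norm_U' R\<^sub>U (l \<mu>) * norm_U R\<^sub>U (u\<^sub>r \<mu> - w\<^sub>p \<mu>)"
proof
  fix \<mu> assume \<mu>: "\<mu> \<in> P"
  let ?V = "{x + y + z | x y z. x \<in> L \<and> y \<in> U\<^sub>r \<and> z \<in> W\<^sub>p}"
  let ?g = "matrix_inv R\<^sub>U *v l \<mu>" and ?d = "u\<^sub>r \<mu> - w\<^sub>p \<mu>"
  have g: "?g \<in> L" using assms(7) \<mu> by blast
  have w: "- w\<^sub>p \<mu> \<in> W\<^sub>p"
    using assms(3) assms(6)[OF \<mu>] by (simp add: is_U_orth_projection_def vec.subspace_neg)
  \<comment> \<open>Padding with zeros exhibits the three summands that membership in
    \<open>?V\<close> asks for; likewise for \<open>?d\<close>, with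
    \<open>- w\<^sub>p \<mu>\<close> as the third.\<close>
  have "?g = ?g + 0 + 0" by simp
  then have gV: "?g \<in> ?V"
    using g vec.subspace_0[OF assms(2)] vec.subspace_0[OF assms(3)] by blast
  have "?d = 0 + u\<^sub>r \<mu> + - w\<^sub>p \<mu>" by simp
  then have dV: "?d \<in> ?V"
    using w assms(5)[OF \<mu>] vec.subspace_0[OF assms(4)] by blast
  \<comment> \<open>The two exact terms combine to \<open>l2_inner (l \<mu>) ?d\<close>, which is
    \<open>inner_U R\<^sub>U ?g ?d\<close>.\<close>
  have "output_qoi (l \<mu>) (u\<^sub>r \<mu>) - corrected_output_qoi R\<^sub>U \<Theta> (l \<mu>) (u\<^sub>r \<mu>) (w\<^sub>p \<mu>)
      = inner_U R\<^sub>U ?g ?d - sketched_inner \<Theta> ?g ?d"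
    by (simp add: output_qoi_def corrected_output_qoi_def inner_U_riesz[OF assms(1)]
        l2_inner_diff_right)
  moreover have "norm (inner_U R\<^sub>U ?g ?d - sketched_inner \<Theta> ?g ?d)
      \<le> \<epsilon> * norm_U R\<^sub>U ?g * norm_U R\<^sub>U ?d"
    using assms(8) gV dV unfolding subspace_embedding_def by blast
  ultimately show "norm (output_qoi (l \<mu>) (u\<^sub>r \<mu>)
        - corrected_output_qoi R\<^sub>U \<Theta> (l \<mu>) (u\<^sub>r \<mu>) (w\<^sub>p \<mu>))
      \<le> \<epsilon> * norm_U' R\<^sub>U (l \<mu>) * norm_U R\<^sub>U ?d"
    by (simp only: norm_U_riesz[OF assms(1)])
qed

end
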